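(* Let $G=(C\cup I,E)$ be a split graph, where $C=\{u_1,\dots,u_n\}$ is a clique and $I=\{v_1,\dots,v_m\}$ is an independent set, and suppose $d_G(u_i)-d_G(v_j)\ge n-1$ for every edge $u_iv_j\in E(G)$. Then: (1) if $n$ is even, $$\Sigma'(G)\le\min\left\{\sum_{i=1}^{n}\frac{(d_G(u_i)-n+1)(d_G(u_i)-n+2)}{2}+\frac{(2\Delta(G)-n+2)n(n-1)}{4},\ \Sigma'(K_n)+\sum_{i=1}^{n}\frac{(d_G(u_i)-n+1)(d_G(u_i)+n)}{2}\right\};$$ (2) if $n$ is odd, $$\Sigma'(G)\le\min\left\{\sum_{i=1}^{n}\frac{(d_G(u_i)-n+1)(d_G(u_i)-n+2)}{2}+\frac{(2\Delta(G)-n+3)n(n-1)}{4},\ \Sigma'(K_n)+\sum_{i=1}^{n}\frac{(d_G(u_i)-n+1)(d_G(u_i)+n+2)}{2}\right\}.$$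
   Context: Graphs are finite, undirected, without loops or multiple edges; $d_G(v)$ is the degree of $v$, $\Delta(G)$ the maximum degree, and $K_n$ the complete graph on $n$ vertices. A split graph is a graph whose vertex set can be partitioned into a clique $C$ and an independent set $I$. A proper edge-coloring is a map $\alpha:E(G)\to\mathbb{N}=\{1,2,\dots\}$ with adjacent edges receiving distinct colors; $\Sigma'(G,\alpha)=\sum_{e\in E(G)}\alpha(e)$ and the edge-chromatic sum is $\Sigma'(G)=\min_\alpha\Sigma'(G,\alpha)$ over all proper edge-colorings $\alpha$ of $G$. *)

theory Defs imports Complex_Main
begin

record 'a graph =
  verts :: "'a set"
  edges :: "'a set set"

definition simple_graph :: "'a graph \<Rightarrow> bool" where
  "simple_graph G \<longleftrightarrow> finite (verts G) \<and> (\<forall>e\<in>edges G. e \<subseteq> verts G \<and> card e = 2)"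

definition vdegree :: "'a graph \<Rightarrow> 'a \<Rightarrow> nat" where
  "vdegree G v = card {e \<in> edges G. v \<in> e}"

(* Unspecified for the graph without vertices. *)
definition max_degree :: "'a graph \<Rightarrow> nat" where
  "max_degree G = Max (vdegree G ` verts G)"

definition complete_graph :: "nat \<Rightarrow> nat graph" where
  "complete_graph n = \<lparr>verts = {1..n}, edges = {e. e \<subseteq> {1..n} \<and> card e = 2}\<rparr>"

definition clique :: "'a graph \<Rightarrow> 'a set \<Rightarrow> bool" where
  "clique G C \<longleftrightarrow> C \<subseteq> verts G \<and> (\<forall>u\<in>C. \<forall>v\<in>C. u \<noteq> v \<longrightarrow> {u, v} \<in> edges G)"

definition independent_set :: "'a graph \<Rightarrow> 'a set \<Rightarrow> bool" where
  "independent_set G I \<longleftrightarrow> I \<subseteq> verts G \<and> (\<forall>u\<in>I. \<forall>v\<in>I. {u, v} \<notin> edges G)"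

definition split_partition :: "'a graph \<Rightarrow> 'a set \<Rightarrow> 'a set \<Rightarrow> bool" where
  "split_partition G C I \<longleftrightarrow>
     verts G = C \<union> I \<and> C \<inter> I = {} \<and> clique G C \<and> independent_set G I"

(* Colors are positive; the values of a coloring outside the edge set are irrelevant. *)
definition proper_edge_coloring :: "'a graph \<Rightarrow> ('a set \<Rightarrow> nat) \<Rightarrow> bool" where
  "proper_edge_coloring G \<alpha> \<longleftrightarrow>
     (\<forall>e\<in>edges G. 1 \<le> \<alpha> e) \<and>
     (\<forall>e\<in>edges G. \<forall>f\<in>edges G. e \<noteq> f \<and> e \<inter> f \<noteq> {} \<longrightarrow> \<alpha> e \<noteq> \<alpha> f)"

definition coloring_sum :: "'a graph \<Rightarrow> ('a set \<Rightarrow> nat) \<Rightarrow> nat" where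
  "coloring_sum G \<alpha> = (\<Sum>e\<in>edges G. \<alpha> e)"

definition edge_chromatic_sum :: "'a graph \<Rightarrow> nat" where
  "edge_chromatic_sum G = (LEAST s. \<exists>\<alpha>. proper_edge_coloring G \<alpha> \<and> s = coloring_sum G \<alpha>)"

lemma simple_graph_finite_edges:
  assumes "simple_graph G"
  shows "finite (edges G)"
proof (rule finite_subset)
  show "edges G \<subseteq> Pow (verts G)" using assms by (auto simp: simple_graph_def)
  show "finite (Pow (verts G))" using assms by (simp add: simple_graph_def)
qed

lemma simple_graph_complete_graph: "simple_graph (complete_graph n)"
  by (simp add: simple_graph_def complete_graph_def)

lemma ex_proper_edge_coloring:
  assumes "simple_graph G"
  shows "\<exists>\<alpha>. proper_edge_coloring G \<alpha>"
proof -
  obtain f :: "'a set \<Rightarrow> nat" where "inj_on f (edges G)"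
    using finite_imp_inj_to_nat_seg[OF simple_graph_finite_edges[OF assms]] by blast
  then have "proper_edge_coloring G (\<lambda>e. Suc (f e))"
    by (auto simp: proper_edge_coloring_def inj_on_def)
  then show ?thesis by blast
qed

lemma edge_chromatic_sum_attained:
  assumes "simple_graph G"
  shows "\<exists>\<alpha>. proper_edge_coloring G \<alpha> \<and> edge_chromatic_sum G = coloring_sum G \<alpha>"
  unfolding edge_chromatic_sum_def
  by (rule LeastI_ex) (use ex_proper_edge_coloring[OF assms] in blast)

lemma edge_chromatic_sum_le:
  assumes "proper_edge_coloring G \<alpha>"
  shows "edge_chromatic_sum G \<le> coloring_sum G \<alpha>"
  unfolding edge_chromatic_sum_def by (rule Least_le) (use assms in blast)

end

(* For u in C let d(u) = deg(u) - n + 1 be its degree in the bipartite graph between C and I. The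
   hypothesis says that d(u) bounds deg(v) on every edge uv, and then Hall's theorem yields a proper
   coloring of the bipartite part with exactly the colors 1..d(u) at each u. The clique has a proper
   coloring with N colors (N = n - 1 or n, whichever is odd) whose classes have at most n div 2 edges;
   it attains the edge-chromatic sum of K_n, since N * (n div 2) = n choose 2. The first bound comes
   from shifting the clique colors by Delta - n + 1, the second from shifting the bipartite ones by N. *)

theory Submission imports Defs "HOL-Number_Theory.Cong"
begin

section \<open>Hall's marriage theorem\<close>

text \<open>Induction on \<open>A\<close>. If some nonempty proper subset is tight, it is matched
  within its neighbourhood and the rest outside of it. If none is, one element takes any of its
  neighbours and the slack of all other subsets absorbs the loss.\<close>

lemma Hall_marriage:
  fixes N :: "'a \<Rightarrow> 'b set"
  assumes "finite A" and "\<And>a. a \<in> A \<Longrightarrow> finite (N a)"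
    and "\<And>S. S \<subseteq> A \<Longrightarrow> card S \<le> card (\<Union>(N ` S))"
  shows "\<exists>f. inj_on f A \<and> (\<forall>a\<in>A. f a \<in> N a)"
  using assms
proof (induction A arbitrary: N rule: finite_psubset_induct)
  case (psubset A)
  have finN: "finite (\<Union>(N ` S))" if "S \<subseteq> A" for S
    using that psubset.hyps psubset.prems(1) finite_subset[of S A] by blast
  show ?case
  proof (cases "A = {}")
    case False
    then obtain a where a: "a \<in> A" by blast
    show ?thesis
    proof (cases "\<exists>S. S \<noteq> {} \<and> S \<subset> A \<and> card (\<Union>(N ` S)) = card S")
      case True
      then obtain S where S: "S \<noteq> {}" "S \<subset> A" "card (\<Union>(N ` S)) = card S" by blast
      let ?U = "\<Union>(N ` S)"
      have finS: "finite S" using S psubset.hyps finite_subset by blast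
      have "\<exists>f. inj_on f S \<and> (\<forall>a\<in>S. f a \<in> N a)"
        by (rule psubset.IH) (use S psubset.prems in auto)
      then obtain f where f: "inj_on f S" "\<forall>a\<in>S. f a \<in> N a" by blast
      have "\<exists>g. inj_on g (A - S) \<and> (\<forall>a\<in>A - S. g a \<in> N a - ?U)"
      proof (rule psubset.IH)
        show "A - S \<subset> A" using S by blast
        show "finite (N a - ?U)" if "a \<in> A - S" for a using that psubset.prems(1) by auto
        show "card T \<le> card (\<Union>a\<in>T. N a - ?U)" if T: "T \<subseteq> A - S" for T
        proof -
          have TA: "T \<subseteq> A" using T by blast
          have finT: "finite T" using TA psubset.hyps finite_subset by blast
          \<comment> \<open>Hall's condition for \<open>S \<union> T\<close>: only
            \<open>card S\<close> of the neighbours lie in \<open>?U\<close>, so at least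
            \<open>card T\<close> remain outside.\<close>
          have eq: "\<Union>(N ` (S \<union> T)) = ?U \<union> (\<Union>a\<in>T. N a - ?U)" by blast
          have "card S + card T = card (S \<union> T)"
            using T finS finT by (intro card_Un_disjoint[symmetric]) auto
          also have "\<dots> \<le> card (\<Union>(N ` (S \<union> T)))"
            using S(2) TA by (intro psubset.prems(2)) auto
          also have "\<dots> \<le> card ?U + card (\<Union>a\<in>T. N a - ?U)"
            unfolding eq by (rule card_Un_le)
          finally show ?thesis using S(3) by simp
        qed
      qed
      then obtain g where g: "inj_on g (A - S)" "\<forall>a\<in>A - S. g a \<in> N a - ?U" by blast
      let ?h = "\<lambda>a. if a \<in> S then f a else g a"
      have "inj_on ?h A"
      proof (rule inj_onI)
        fix x y assume xy: "x \<in> A" "y \<in> A" "?h x = ?h y"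
        have sep: "f s \<noteq> g t" if "s \<in> S" "t \<in> A - S" for s t
        proof -
          have "f s \<in> ?U" using f(2) that(1) by blast
          moreover have "g t \<notin> ?U" using g(2) that(2) by blast
          ultimately show ?thesis by auto
        qed
        show "x = y"
        proof (cases "x \<in> S"; cases "y \<in> S")
          assume "x \<in> S" "y \<in> S" then show ?thesis using xy f(1) by (auto dest: inj_onD)
        next
          assume "x \<in> S" "y \<notin> S" then show ?thesis using xy sep[of x y] by simp
        next
          assume "x \<notin> S" "y \<in> S" then show ?thesis using xy sep[of y x] by simp
        next
          assume "x \<notin> S" "y \<notin> S" then show ?thesis using xy g(1) by (auto dest: inj_onD)
        qed
      qed
      moreover have "\<forall>a\<in>A. ?h a \<in> N a" using f(2) g(2) by simp
      ultimately show ?thesis by (intro exI[of _ ?h] conjI)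
    next
      case strict: False
      have "card {a} \<le> card (\<Union>(N ` {a}))" using a by (intro psubset.prems(2)) auto
      then obtain x where x: "x \<in> N a" by fastforce
      have "\<exists>g. inj_on g (A - {a}) \<and> (\<forall>b\<in>A - {a}. g b \<in> N b - {x})"
      proof (rule psubset.IH)
        show "A - {a} \<subset> A" using a by blast
        show "finite (N b - {x})" if "b \<in> A - {a}" for b using that psubset.prems(1) by auto
        show "card T \<le> card (\<Union>b\<in>T. N b - {x})" if T: "T \<subseteq> A - {a}" for T
        proof (cases "T = {}")
          case False
          have TA: "T \<subset> A" using T a by blast
          have "card T \<le> card (\<Union>(N ` T))" using TA by (intro psubset.prems(2)) auto
          \<comment> \<open>\<open>T\<close> is not tight, so it has a neighbour to spare when
            \<open>x\<close> is removed.\<close>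
          moreover have "card (\<Union>(N ` T)) \<noteq> card T" using strict TA False by blast
          ultimately have "card T < card (\<Union>(N ` T))" by simp
          moreover have "(\<Union>b\<in>T. N b - {x}) = \<Union>(N ` T) - {x}" by blast
          moreover have "card (\<Union>(N ` T)) - 1 \<le> card (\<Union>(N ` T) - {x})"
            by (simp add: card_Diff_singleton_if)
          ultimately show ?thesis by simp
        qed simp
      qed
      then obtain g where g: "inj_on g (A - {a})" "\<forall>b\<in>A - {a}. g b \<in> N b - {x}" by blast
      have "inj_on (g(a := x)) A"
        using g by (force simp: inj_on_def)
      moreover have "\<forall>b\<in>A. (g(a := x)) b \<in> N b" using g(2) x by simp
      ultimately show ?thesis by blast
    qed
  qed simp
qed

section \<open>Matchings in bipartite graphs\<close>

text \<open>Giving each vertex v a loop of weight k - deg v makes the graph k-regular, so Hall's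
  condition holds by counting weights.\<close>

lemma neighbour_permutation:
  fixes N :: "'a \<Rightarrow> 'a set"
  assumes fin: "finite V" and N: "\<And>v. v \<in> V \<Longrightarrow> N v \<subseteq> V"
    and sym: "\<And>u v. u \<in> N v \<Longrightarrow> v \<in> N u"
    and deg: "\<And>v. v \<in> V \<Longrightarrow> card (N v) \<le> k" and k: "k > 0"
  shows "\<exists>f. bij_betw f V V \<and> (\<forall>v\<in>V. f v \<in> N v \<or> f v = v \<and> card (N v) < k)"
proof -
  define P where "P v = N v \<union> (if card (N v) < k then {v} else {})" for v
  define w where "w u v = (if u \<in> N v then 1 else 0) + (if u = v then k - card (N v) else 0)" for u v
  have PV: "P v \<subseteq> V" if "v \<in> V" for v using N[OF that] that by (auto simp: P_def)
  have finP: "finite (P v)" if "v \<in> V" for v using PV[OF that] fin finite_subset by blast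
  have wsym: "w u v = w v u" for u v using sym[of u v] sym[of v u] by (auto simp: w_def)
  have wsum: "(\<Sum>u\<in>V. w u v) = k" if v: "v \<in> V" for v
  proof -
    have "(\<Sum>u\<in>V. w u v) = card (V \<inter> N v) + (k - card (N v))"
      using fin v by (simp add: w_def sum.distrib sum.If_cases Int_def)
    moreover have "V \<inter> N v = N v" using N[OF v] by blast
    ultimately show ?thesis using deg[OF v] by simp
  qed
  have "\<exists>f. inj_on f V \<and> (\<forall>v\<in>V. f v \<in> P v)"
  proof (rule Hall_marriage)
    fix S assume S: "S \<subseteq> V"
    let ?T = "\<Union>(P ` S)"
    have T: "?T \<subseteq> V" using S PV by blast
    \<comment> \<open>Double counting: the weight \<open>k * card S\<close> at \<open>S\<close> all
      lands in \<open>?T\<close>, and each vertex of \<open>?T\<close> receives at most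
      \<open>k\<close>.\<close>
    have "k * card S = (\<Sum>v\<in>S. \<Sum>u\<in>V. w u v)"
      using wsum S by (simp add: subset_eq)
    also have "\<dots> = (\<Sum>v\<in>S. \<Sum>u\<in>?T. w u v)"
    proof (rule sum.cong[OF refl], rule sum.mono_neutral_right[OF fin T], rule ballI)
      fix v u assume "v \<in> S" and "u \<in> V - ?T"
      then have "u \<notin> P v" by blast
      then show "w u v = 0" by (auto simp: w_def P_def split: if_splits)
    qed
    also have "\<dots> = (\<Sum>u\<in>?T. \<Sum>v\<in>S. w v u)"
      by (subst sum.swap) (simp add: wsym)
    also have "\<dots> \<le> (\<Sum>u\<in>?T. \<Sum>v\<in>V. w v u)"
      using S fin by (intro sum_mono sum_mono2) auto
    also have "\<dots> = (\<Sum>u\<in>?T. k)"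
      using wsum T by (intro sum.cong) auto
    finally show "card S \<le> card ?T" using k by (simp add: mult.commute)
  qed (use fin finP in auto)
  then obtain f where f: "inj_on f V" "\<forall>v\<in>V. f v \<in> P v" by blast
  have "f ` V = V" using f PV fin by (intro endo_inj_surj) auto
  then have "bij_betw f V V" using f(1) by (simp add: bij_betw_def)
  moreover have "\<forall>v\<in>V. f v \<in> N v \<or> f v = v \<and> card (N v) < k"
    using f(2) by (auto simp: P_def split: if_splits)
  ultimately show ?thesis by blast
qed

text \<open>\<open>neighbour_permutation\<close> is applied to the underlying undirected graph, and
  \<open>M\<close> keeps the edges that the permutation follows from left to right. A vertex of
  degree \<open>k\<close> is never fixed, so on the left it is mapped along an edge, and on the
  right it is reached along one.\<close>

lemma matching_covering_max_degree:
  fixes E :: "('a \<times> 'a) set"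
  assumes fin: "finite E" and disj: "Domain E \<inter> Range E = {}"
    and degX: "\<And>x. card (E `` {x}) \<le> k" and degY: "\<And>y. card (E\<inverse> `` {y}) \<le> k" and k: "k > 0"
  shows "\<exists>M\<subseteq>E. single_valued M \<and> single_valued (M\<inverse>) \<and>
           (\<forall>x. card (E `` {x}) = k \<longrightarrow> x \<in> Domain M) \<and> (\<forall>y. card (E\<inverse> `` {y}) = k \<longrightarrow> y \<in> Range M)"
proof -
  define V where "V = Domain E \<union> Range E"
  define N where "N v = (E \<union> E\<inverse>) `` {v}" for v
  \<comment> \<open>No vertex lies on both sides, so its neighbours are either all successors or all
    predecessors.\<close>
  have NX: "N x = E `` {x}" if "x \<in> Domain E" for x using that disj by (auto simp: N_def)
  have NY: "N y = E\<inverse> `` {y}" if "y \<in> Range E" for y using that disj by (auto simp: N_def)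
  have "\<exists>f. bij_betw f V V \<and> (\<forall>v\<in>V. f v \<in> N v \<or> f v = v \<and> card (N v) < k)"
  proof (rule neighbour_permutation)
    show "finite V" using fin by (simp add: V_def finite_Domain finite_Range)
    show "card (N v) \<le> k" if "v \<in> V" for v
      using that NX NY degX degY unfolding V_def by fastforce
    show "N v \<subseteq> V" for v by (auto simp: N_def V_def)
    show "v \<in> N u" if "u \<in> N v" for u v using that by (auto simp: N_def)
  qed (rule k)
  then obtain f where f: "bij_betw f V V" "\<And>v. v \<in> V \<Longrightarrow> f v \<in> N v \<or> f v = v \<and> card (N v) < k"
    by blast
  define M where "M = {(x, y) \<in> E. f x = y}"
  have inj: "inj_on f V" using f(1) by (rule bij_betw_imp_inj_on)
  have "single_valued M" by (auto simp: M_def single_valued_def)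
  moreover have "single_valued (M\<inverse>)"
    using inj unfolding M_def V_def single_valued_def inj_on_def by blast
  moreover have "x \<in> Domain M" if x: "card (E `` {x}) = k" for x
  proof -
    have xE: "x \<in> Domain E" using x k by (metis DomainI Image_singleton_iff card.empty equals0I less_numeral_extra(3))
    then have "f x \<in> E `` {x}" using f(2)[of x] NX[OF xE] x by (auto simp: V_def)
    then show ?thesis by (auto simp: M_def)
  qed
  moreover have "y \<in> Range M" if y: "card (E\<inverse> `` {y}) = k" for y
  proof -
    have "E\<inverse> `` {y} \<noteq> {}" using y k by (metis card.empty less_numeral_extra(3))
    then have yE: "y \<in> Range E" by auto
    then have "y \<in> f ` V" using f(1) by (auto simp: bij_betw_def V_def)
    then obtain z where z: "z \<in> V" "f z = y" by blast
    \<comment> \<open>\<open>z\<close> is not a fixed point: otherwise \<open>z = y\<close>, whose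
      degree is the full \<open>k\<close>.\<close>
    have "y \<in> N z" using f(2)[OF z(1)] z(2) y NY[OF yE] by auto
    then have "(z, y) \<in> E" using yE disj by (auto simp: N_def)
    then show ?thesis using z by (auto simp: M_def)
  qed
  moreover have "M \<subseteq> E" by (auto simp: M_def)
  ultimately show ?thesis by blast
qed

section \<open>Coloring bipartite graphs from initial segments of colors\<close>

text \<open>The largest color k goes to a matching between the degree-k vertices of the left side and the
  right side; covering also all right vertices of degree k keeps the degree condition for the rest.\<close>

lemma bipartite_coloring_initial_palette:
  fixes E :: "('a \<times> 'a) set"
  assumes "finite E" "Domain E \<inter> Range E = {}" "\<And>x. card (E `` {x}) \<le> k"
    and "\<And>x y. (x, y) \<in> E \<Longrightarrow> card (E\<inverse> `` {y}) \<le> card (E `` {x})"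
  shows "\<exists>c :: 'a \<times> 'a \<Rightarrow> nat. (\<forall>(x, y)\<in>E. c (x, y) \<in> {1..card (E `` {x})}) \<and>
           (\<forall>x. inj_on (\<lambda>y. c (x, y)) (E `` {x})) \<and> (\<forall>y. inj_on (\<lambda>x. c (x, y)) (E\<inverse> `` {y}))"
  using assms
proof (induction k arbitrary: E)
  case 0
  have "finite (E `` {x})" for x using 0(1) by (rule finite_Image)
  then have "E `` {x} = {}" for x using 0(3)[of x] by simp
  then have "E = {}" by auto
  then show ?case by simp
next
  case (Suc k)
  note fin = Suc.prems(1) and disj = Suc.prems(2) and degX = Suc.prems(3) and le = Suc.prems(4)
  have finX: "finite (E `` {x})" and finY: "finite (E\<inverse> `` {x})" for x
    using fin by (simp_all add: finite_Image)
  \<comment> \<open>Only left vertices of degree \<open>Suc k\<close> may use the top color, and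
    each of them must use it.\<close>
  define F where "F = {(x, y) \<in> E. card (E `` {x}) = Suc k}"
  have FE: "F \<subseteq> E" by (auto simp: F_def)
  have FX: "F `` {x} = (if card (E `` {x}) = Suc k then E `` {x} else {})" for x
    by (auto simp: F_def)
  have "\<exists>M\<subseteq>F. single_valued M \<and> single_valued (M\<inverse>) \<and>
      (\<forall>x. card (F `` {x}) = Suc k \<longrightarrow> x \<in> Domain M) \<and>
      (\<forall>y. card (F\<inverse> `` {y}) = Suc k \<longrightarrow> y \<in> Range M)"
  proof (rule matching_covering_max_degree)
    show "finite F" using FE fin finite_subset by blast
    show "Domain F \<inter> Range F = {}" using disj FE by blast
    show "card (F `` {x}) \<le> Suc k" for x using FX[of x] by simp
    \<comment> \<open>A right vertex met by \<open>F\<close> has a left neighbour of degree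
      \<open>Suc k\<close>, so by \<open>le\<close> its own degree is at most that.\<close>
    show "card (F\<inverse> `` {y}) \<le> Suc k" for y
    proof (cases "F\<inverse> `` {y} = {}")
      case False
      then obtain x where x: "(x, y) \<in> E" "card (E `` {x}) = Suc k" by (auto simp: F_def)
      have "card (F\<inverse> `` {y}) \<le> card (E\<inverse> `` {y})" using FE finY by (intro card_mono) auto
      then show ?thesis using le[OF x(1)] x(2) by simp
    qed simp
  qed simp
  then obtain M where M: "M \<subseteq> F" "single_valued M" "single_valued (M\<inverse>)"
    "\<And>x. card (F `` {x}) = Suc k \<Longrightarrow> x \<in> Domain M"
    "\<And>y. card (F\<inverse> `` {y}) = Suc k \<Longrightarrow> y \<in> Range M" by blast
  let ?E = "E - M"
  have ME: "M \<subseteq> E" using M(1) FE by blast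
  have small: "?E `` {x} = E `` {x}" if "card (E `` {x}) \<noteq> Suc k" for x
    using that M(1) by (auto simp: F_def)
  have large: "card (?E `` {x}) = k" if x: "card (E `` {x}) = Suc k" for x
  proof -
    have "x \<in> Domain M" using M(4) FX x by simp
    then obtain y where y: "(x, y) \<in> M" by blast
    then have "?E `` {x} = E `` {x} - {y}" using M(2) by (auto simp: single_valued_def)
    moreover have "y \<in> E `` {x}" using y ME by blast
    ultimately show ?thesis using x by simp
  qed
  have deg: "card (?E `` {x}) \<le> k" for x
    using small[of x] large[of x] degX[of x] by (cases "card (E `` {x}) = Suc k") auto
  have mono: "card (?E `` {x}) \<le> card (E `` {x})" for x
    using finX by (intro card_mono) auto
  have monoY: "card (?E\<inverse> `` {y}) \<le> card (E\<inverse> `` {y})" for y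
    using finY by (intro card_mono) auto
  have "\<exists>c :: 'a \<times> 'a \<Rightarrow> nat. (\<forall>(x, y)\<in>?E. c (x, y) \<in> {1..card (?E `` {x})}) \<and>
           (\<forall>x. inj_on (\<lambda>y. c (x, y)) (?E `` {x})) \<and> (\<forall>y. inj_on (\<lambda>x. c (x, y)) (?E\<inverse> `` {y}))"
  proof (rule Suc.IH)
    \<comment> \<open>Only at a left vertex of degree \<open>Suc k\<close> does the left degree
      drop, to \<open>k\<close>. If \<open>y\<close> had degree \<open>Suc k\<close> as well, then
      by \<open>le\<close> all its neighbours have full degree, so all its edges are in
      \<open>F\<close> and \<open>M\<close> takes one of them away.\<close>
    show "card (?E\<inverse> `` {y}) \<le> card (?E `` {x})" if xy: "(x, y) \<in> ?E" for x y
    proof (cases "card (E `` {x}) = Suc k")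
      case False
      then show ?thesis using small[OF False] monoY[of y] le[of x y] xy by simp
    next
      case True
      have "card (?E\<inverse> `` {y}) \<le> k"
      proof (cases "card (E\<inverse> `` {y}) \<le> k")
        case False
        have yk: "card (E\<inverse> `` {y}) = Suc k" using False le[of x y] xy True by auto
        have "card (E `` {x'}) = Suc k" if "(x', y) \<in> E" for x'
          using le[OF that] degX[of x'] yk by simp
        then have "F\<inverse> `` {y} = E\<inverse> `` {y}" by (auto simp: F_def)
        then obtain z where z: "(z, y) \<in> M" using M(5)[of y] yk by auto
        then have "?E\<inverse> `` {y} \<subseteq> E\<inverse> `` {y} - {z}" by auto
        then have "card (?E\<inverse> `` {y}) \<le> card (E\<inverse> `` {y} - {z})" using finY by (intro card_mono) auto
        moreover have "z \<in> E\<inverse> `` {y}" using z ME by blast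
        ultimately show ?thesis using yk by simp
      qed (use monoY[of y] in simp)
      then show ?thesis using large[OF True] by simp
    qed
  qed (use fin disj deg in auto)
  then obtain c :: "'a \<times> 'a \<Rightarrow> nat" where
    c: "\<And>x y. (x, y) \<in> ?E \<Longrightarrow> c (x, y) \<in> {1..card (?E `` {x})}"
      "\<And>x. inj_on (\<lambda>y. c (x, y)) (?E `` {x})" "\<And>y. inj_on (\<lambda>x. c (x, y)) (?E\<inverse> `` {y})"
    by blast
  define c' where "c' e = (if e \<in> M then Suc k else c e)" for e
  have range': "c' (x, y) \<in> {1..card (E `` {x})}" if "(x, y) \<in> E" for x y
  proof (cases "(x, y) \<in> M")
    case True
    then show ?thesis using M(1) by (auto simp: c'_def F_def)
  next
    case False
    then show ?thesis using c(1)[of x y] that mono[of x] by (auto simp: c'_def)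
  qed
  \<comment> \<open>The old colors are at most \<open>k\<close>, as every left degree in
    \<open>?E\<close> is.\<close>
  have new: "c' e \<noteq> c' e'" if "e \<in> M" "e' \<in> ?E" for e e'
  proof -
    obtain x y where e': "e' = (x, y)" by fastforce
    show ?thesis using c(1)[of x y] that deg[of x] by (auto simp: c'_def e')
  qed
  have "inj_on (\<lambda>y. c' (x, y)) (E `` {x})" for x
  proof (rule inj_onI)
    fix y z assume yz: "y \<in> E `` {x}" "z \<in> E `` {x}" and eq: "c' (x, y) = c' (x, z)"
    show "y = z"
    proof (cases "(x, y) \<in> M \<or> (x, z) \<in> M")
      case True
      then have "(x, y) \<in> M \<and> (x, z) \<in> M"
        using new[of "(x, y)" "(x, z)"] new[of "(x, z)" "(x, y)"] eq yz by auto
      then show ?thesis using M(2) by (auto simp: single_valued_def)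
    next
      case False
      then show ?thesis using inj_onD[OF c(2)[of x], of y z] eq yz by (auto simp: c'_def)
    qed
  qed
  moreover have "inj_on (\<lambda>x. c' (x, y)) (E\<inverse> `` {y})" for y
  proof (rule inj_onI)
    fix x z assume xz: "x \<in> E\<inverse> `` {y}" "z \<in> E\<inverse> `` {y}" and eq: "c' (x, y) = c' (z, y)"
    show "x = z"
    proof (cases "(x, y) \<in> M \<or> (z, y) \<in> M")
      case True
      then have "(x, y) \<in> M \<and> (z, y) \<in> M"
        using new[of "(x, y)" "(z, y)"] new[of "(z, y)" "(x, y)"] eq xz by auto
      then show ?thesis using M(3) by (auto simp: single_valued_def)
    next
      case False
      then show ?thesis using inj_onD[OF c(3)[of y], of x z] eq xz by (auto simp: c'_def)
    qed
  qed
  ultimately show ?case using range' by (intro exI[of _ c']) auto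
qed


section \<open>Edge colorings of complete graphs\<close>

text \<open>With the vertices other than z numbered by residues modulo the odd number N, the edge between
  a and b gets the color g a + g b; at a this leaves exactly the color 2 g a unused, which is given to
  the edge from a to z.\<close>

lemma complete_graph_coloring:
  fixes C :: "'a set"
  assumes fin: "finite C" and N: "odd N" and card: "card C \<le> N + 1"
  shows "\<exists>c. proper_edge_coloring \<lparr>verts = C, edges = {e. e \<subseteq> C \<and> card e = 2}\<rparr> c \<and>
           (\<forall>e. c e \<in> {1..N})"
proof (cases "C = {}")
  case True
  then show ?thesis
    using N by (intro exI[of _ "\<lambda>_. 1"]) (auto simp: proper_edge_coloring_def elim: oddE)
next
  case False
  then obtain z where z: "z \<in> C" by blast
  obtain g :: "'a \<Rightarrow> nat" where "inj_on g (C - {z})" "g ` (C - {z}) \<subseteq> {..<N}"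
  proof -
    have "card (C - {z}) \<le> card {..<N}" using card z by simp
    then show ?thesis using card_le_inj[of "C - {z}" "{..<N}"] fin that by blast
  qed
  \<comment> \<open>The numbers lie below \<open>N\<close>, so they are determined by their
    residues.\<close>
  then have g_inj: "a = b" if "a \<in> C" "b \<in> C" "a \<noteq> z" "b \<noteq> z" "[g a = g b] (mod N)" for a b
    using that by (intro inj_onD[of g "C - {z}"]) (auto simp: image_subset_iff intro: cong_less_modulus_unique_nat)
  \<comment> \<open>For \<open>e = {a, z}\<close> the sum over \<open>e - {z}\<close> is
    \<open>g a\<close>, whence the color \<open>2 * g a\<close>. Adding 1 moves the residues into
    \<open>{1..N}\<close>.\<close>
  define c where "c e = (if z \<in> e then 2 * sum g (e - {z}) else sum g e) mod N + 1" for e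
  have cz: "c {a, z} = 2 * g a mod N + 1" "c {z, a} = 2 * g a mod N + 1" if "a \<noteq> z" for a
    using that by (simp_all add: c_def insert_Diff_if)
  have cn: "c {a, b} = (g a + g b) mod N + 1" if "a \<noteq> z" "b \<noteq> z" "a \<noteq> b" for a b
    using that by (simp add: c_def)
  have adjacent: "c {a, b} \<noteq> c {a, d}" if abd: "a \<in> C" "b \<in> C" "d \<in> C" "a \<noteq> b" "a \<noteq> d" "b \<noteq> d" for a b d
  proof
    assume eq: "c {a, b} = c {a, d}"
    consider "a = z" | "b = z" | "d = z" | "a \<noteq> z" "b \<noteq> z" "d \<noteq> z" by blast
    then show False
    proof cases
      case 1
      then have "[2 * g b = 2 * g d] (mod N)" using eq abd by (simp add: cz cong_def)
      \<comment> \<open>2 is invertible modulo the odd number \<open>N\<close>.\<close>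
      then have "[g b = g d] (mod N)" using N by (simp add: cong_mult_lcancel_nat)
      then show False using g_inj abd 1 by blast
    next
      case 2
      \<comment> \<open>Seen from \<open>a\<close>, the vertex \<open>z\<close> acts as if it
        carried the number \<open>g a\<close>, which no other neighbour of \<open>a\<close>
        has.\<close>
      then have "[g a + g a = g a + g d] (mod N)" using eq abd by (simp add: cz cn cong_def mult_2)
      then show False using g_inj abd 2 cong_add_lcancel_nat by blast
    next
      case 3
      then have "[g a + g b = g a + g a] (mod N)" using eq abd by (simp add: cz cn cong_def mult_2)
      then show False using g_inj abd 3 cong_add_lcancel_nat by blast
    next
      case 4
      then have "[g a + g b = g a + g d] (mod N)" using eq abd by (simp add: cn cong_def)
      then show False using g_inj abd 4 cong_add_lcancel_nat by blast
    qed
  qed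
  have range: "c e \<in> {1..N}" for e
    using N by (auto simp: c_def Suc_le_eq intro!: mod_less_divisor elim: oddE)
  have "c e \<noteq> c f" if e: "e \<subseteq> C" "card e = 2" and f: "f \<subseteq> C" "card f = 2"
    and ef: "e \<noteq> f" "e \<inter> f \<noteq> {}" for e f
  proof -
    obtain a where a: "a \<in> e" "a \<in> f" using ef by blast
    obtain b where b: "e = {a, b}" "a \<noteq> b" using e a by (auto simp: card_2_iff)
    obtain d where d: "f = {a, d}" "a \<noteq> d" using f a by (auto simp: card_2_iff)
    show ?thesis using adjacent[of a b d] b d e f ef by auto
  qed
  then have "proper_edge_coloring \<lparr>verts = C, edges = {e. e \<subseteq> C \<and> card e = 2}\<rparr> c"
    using range by (simp add: proper_edge_coloring_def)
  then show ?thesis using range by blast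
qed

section \<open>Color classes and sums of colors\<close>

lemma card_disjoint_pairs_le:
  assumes "finite C" "P \<subseteq> {e. e \<subseteq> C \<and> card e = 2}" "pairwise disjnt P"
  shows "card P \<le> card C div 2"
proof -
  have "card (\<Union>P) = (\<Sum>e\<in>P. card e)"
    using assms by (intro card_Union_disjoint) (auto intro: finite_subset)
  also have "\<dots> = (\<Sum>e\<in>P. 2)" using assms(2) by (intro sum.cong) auto
  finally have "2 * card P = card (\<Union>P)" by simp
  also have "\<dots> \<le> card C" using assms by (intro card_mono) auto
  finally show ?thesis by simp
qed

text \<open>Grouping by color leaves at most \<open>h\<close> terms per color. With the identity as
  weight this bounds a sum of colors from above; with a decreasing weight it serves to bound one
  from below.\<close>

lemma sum_weight_le:
  fixes \<alpha> :: "'e \<Rightarrow> nat" and w :: "nat \<Rightarrow> nat"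
  assumes "finite E" and h: "\<And>i. card {e \<in> E. \<alpha> e = i} \<le> h"
  shows "(\<Sum>e\<in>{e \<in> E. \<alpha> e \<in> {1..N}}. w (\<alpha> e)) \<le> (\<Sum>i=1..N. w i) * h"
proof -
  let ?E = "{e \<in> E. \<alpha> e \<in> {1..N}}"
  have "(\<Sum>e\<in>?E. w (\<alpha> e)) = (\<Sum>i=1..N. \<Sum>e\<in>{e \<in> ?E. \<alpha> e = i}. w (\<alpha> e))"
    using assms(1) by (intro sum.group[symmetric]) auto
  also have "\<dots> \<le> (\<Sum>i=1..N. w i * h)"
  proof (rule sum_mono)
    fix i assume i: "i \<in> {1..N}"
    then have "{e \<in> ?E. \<alpha> e = i} = {e \<in> E. \<alpha> e = i}" by auto
    then have "(\<Sum>e\<in>{e \<in> ?E. \<alpha> e = i}. w (\<alpha> e)) = (\<Sum>e\<in>{e \<in> E. \<alpha> e = i}. w i)" by simp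
    also have "\<dots> \<le> w i * h" using h[of i] by (simp add: mult.commute)
    finally show "(\<Sum>e\<in>{e \<in> ?E. \<alpha> e = i}. w (\<alpha> e)) \<le> w i * h" .
  qed
  finally show ?thesis by (simp add: sum_distrib_right)
qed

text \<open>With at most \<open>h\<close> elements per color, the cheapest choice fills the colors
  \<open>1..N\<close> completely. The proof measures how far each color falls short of
  \<open>N + 1\<close> and bounds the total deficit by \<open>sum_weight_le\<close>.\<close>

lemma sum_coloring_ge:
  fixes \<alpha> :: "'e \<Rightarrow> nat"
  assumes fin: "finite E" and h: "\<And>i. card {e \<in> E. \<alpha> e = i} \<le> h"
    and pos: "\<And>e. e \<in> E \<Longrightarrow> 1 \<le> \<alpha> e" and card: "card E = N * h"
  shows "(\<Sum>i=1..N. i) * h \<le> (\<Sum>e\<in>E. \<alpha> e)"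
proof -
  \<comment> \<open>Truncated subtraction makes the deficit 0 above \<open>N\<close>, so color plus
    deficit is at least \<open>N + 1\<close> for every color.\<close>
  let ?w = "\<lambda>i. N + 1 - i"
  have "(N + 1) * N * h = (\<Sum>e\<in>E. N + 1)" using card by (simp add: algebra_simps)
  also have "\<dots> \<le> (\<Sum>e\<in>E. \<alpha> e + ?w (\<alpha> e))" by (intro sum_mono) simp
  also have "\<dots> = (\<Sum>e\<in>E. \<alpha> e) + (\<Sum>e\<in>{e \<in> E. \<alpha> e \<in> {1..N}}. ?w (\<alpha> e))"
    using fin pos unfolding sum.distrib
    by (intro arg_cong2[where f="(+)"] refl sum.mono_neutral_right) force+
  also have "\<dots> \<le> (\<Sum>e\<in>E. \<alpha> e) + (\<Sum>i=1..N. ?w i) * h"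
    using sum_weight_le[OF fin h, where w = "?w"] by simp
  finally have "(N + 1) * N * h \<le> (\<Sum>e\<in>E. \<alpha> e) + (\<Sum>i=1..N. ?w i) * h" .
  moreover have "(\<Sum>i=1..N. ?w i) + (\<Sum>i=1..N. i) = (N + 1) * N"
    by (simp add: sum.distrib[symmetric])
  ultimately show ?thesis
    by (metis add.commute add_le_cancel_right add_mult_distrib)
qed

text \<open>A color class is a matching.\<close>

lemma proper_edge_coloring_class_le:
  assumes fin: "finite C" and E: "edges G = {e. e \<subseteq> C \<and> card e = 2}"
    and \<alpha>: "proper_edge_coloring G \<alpha>"
  shows "card {e \<in> edges G. \<alpha> e = i} \<le> card C div 2"
proof (rule card_disjoint_pairs_le[OF fin])
  show "pairwise disjnt {e \<in> edges G. \<alpha> e = i}"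
    using \<alpha> unfolding proper_edge_coloring_def pairwise_def disjnt_def by blast
qed (use E in blast)

text \<open>By hypothesis \<open>N\<close> classes of the largest possible size
  \<open>n div 2\<close> account for all edges, so \<open>sum_coloring_ge\<close> applies. The same
  value bounds the sum of the \<open>N\<close>-coloring of the clique from above, which makes that
  coloring optimal.\<close>

lemma edge_chromatic_sum_complete_graph_ge:
  assumes N: "n choose 2 = N * (n div 2)"
  shows "(\<Sum>i=1..N. i) * (n div 2) \<le> edge_chromatic_sum (complete_graph n)"
proof -
  let ?K = "complete_graph n"
  obtain \<alpha> where \<alpha>: "proper_edge_coloring ?K \<alpha>" "edge_chromatic_sum ?K = coloring_sum ?K \<alpha>"
    using edge_chromatic_sum_attained[OF simple_graph_complete_graph] by blast
  have E: "edges ?K = {e. e \<subseteq> {1..n} \<and> card e = 2}" by (simp add: complete_graph_def)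
  show ?thesis unfolding \<alpha>(2) coloring_sum_def
  proof (rule sum_coloring_ge)
    show "finite (edges ?K)" by (rule simple_graph_finite_edges[OF simple_graph_complete_graph])
    show "card {e \<in> edges ?K. \<alpha> e = i} \<le> n div 2" for i
      using proper_edge_coloring_class_le[OF _ E \<alpha>(1)] by simp
    show "1 \<le> \<alpha> e" if "e \<in> edges ?K" for e
      using \<alpha>(1) that by (simp add: proper_edge_coloring_def)
    show "card (edges ?K) = N * (n div 2)"
      using N n_subsets[of "{1..n}" 2] by (simp add: E)
  qed
qed

section \<open>Coloring a split graph\<close>

lemma sum_inj_initial_segment:
  fixes f :: "'a \<Rightarrow> nat"
  assumes "finite A" "inj_on f A" "f ` A \<subseteq> {1..card A}"
  shows "(\<Sum>a\<in>A. f a) = (\<Sum>i=1..card A. i)"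
proof -
  have "f ` A = {1..card A}" using assms by (intro card_subset_eq) (auto simp: card_image)
  then show ?thesis using sum.reindex[OF assms(2), of "\<lambda>i. i"] by simp
qed

text \<open>Here \<open>a\<close> shifts the clique colors and \<open>b\<close> the colors of the
  crossing edges between \<open>C\<close> and \<open>I\<close>. The assumption on them offers two
  ways to keep the ranges apart: the clique above all crossing edges, or the crossing edges above
  the \<open>N\<close> clique colors. In the bound the crossing edges are grouped by their end in
  \<open>C\<close>.\<close>

lemma split_graph_coloring:
  fixes G :: "'a graph" and C :: "'a set"
  defines "d \<equiv> \<lambda>u. vdegree G u + 1 - card C"
  assumes simple: "simple_graph G" and split: "split_partition G C I"
    and cond: "\<And>u v. u \<in> C \<Longrightarrow> v \<in> I \<Longrightarrow> {u, v} \<in> edges G \<Longrightarrow> vdegree G v \<le> d u"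
    and N: "odd N" "card C \<le> N + 1"
    and ab: "b = 0 \<and> (\<forall>u\<in>C. d u \<le> a) \<or> a = 0 \<and> b = N"
  shows "edge_chromatic_sum G \<le> a * (card C choose 2) + (\<Sum>i=1..N. i) * (card C div 2)
           + (\<Sum>u\<in>C. b * d u + (\<Sum>i=1..d u. i))"
proof -
  have CI: "verts G = C \<union> I" "C \<inter> I = {}"
    and clique: "\<And>u v. u \<in> C \<Longrightarrow> v \<in> C \<Longrightarrow> u \<noteq> v \<Longrightarrow> {u, v} \<in> edges G"
    and indep: "\<And>u v. u \<in> I \<Longrightarrow> v \<in> I \<Longrightarrow> {u, v} \<notin> edges G"
    using split by (auto simp: split_partition_def clique_def independent_set_def)
  have fin: "finite C" "finite I" using simple CI by (simp_all add: simple_graph_def)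
  \<comment> \<open>Crossing edges are oriented from \<open>C\<close> to \<open>I\<close>, to match
    the relational form of the bipartite lemma.\<close>
  define E where "E = {(u, v). u \<in> C \<and> v \<in> I \<and> {u, v} \<in> edges G}"
  define K where "K = {e. e \<subseteq> C \<and> card e = 2}"
  have finE: "finite E" by (rule finite_subset[of _ "C \<times> I"]) (use fin in \<open>auto simp: E_def\<close>)
  have finK: "finite K" using fin by (simp add: K_def)
  have edge_cases: "e \<in> K \<or> (\<exists>u v. (u, v) \<in> E \<and> e = {u, v})" if e: "e \<in> edges G" for e
  proof -
    have e2: "e \<subseteq> C \<union> I" "card e = 2" using simple e CI(1) by (simp_all add: simple_graph_def)
    then obtain x y where xy: "e = {x, y}" by (auto simp: card_2_iff)
    have yx: "{y, x} = e" using xy by blast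
    consider "x \<in> C" "y \<in> C" | "x \<in> C" "y \<in> I" | "x \<in> I" "y \<in> C"
      using e2(1) xy indep[of x y] e by auto
    then show ?thesis
    proof cases
      case 1
      then show ?thesis using e2(2) xy by (simp add: K_def)
    next
      case 2
      then have "(x, y) \<in> E" using e xy by (simp add: E_def)
      then show ?thesis using xy by blast
    next
      case 3
      then have "(y, x) \<in> E" using e yx by (simp add: E_def)
      then show ?thesis using yx by blast
    qed
  qed
  have edges: "edges G = K \<union> (\<lambda>(u, v). {u, v}) ` E"
  proof (intro equalityI subsetI)
    fix e assume "e \<in> edges G"
    then show "e \<in> K \<union> (\<lambda>(u, v). {u, v}) ` E" using edge_cases[of e] by force
  next
    fix e assume "e \<in> K \<union> (\<lambda>(u, v). {u, v}) ` E"
    then show "e \<in> edges G" using clique by (auto simp: E_def K_def card_2_iff)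
  qed
  have E_not_clique: "\<not> {u, v} \<subseteq> C" if "(u, v) \<in> E" for u v
    using that CI(2) by (auto simp: E_def)
  have inj: "inj_on (\<lambda>(u, v). {u, v}) E"
    using CI(2) by (auto simp: inj_on_def E_def doubleton_eq_iff)

  \<comment> \<open>The clique accounts for \<open>card C - 1\<close> of the edges at
    \<open>u\<close>, so the subtraction in \<open>d\<close> is exact.\<close>
  have dC: "card (E `` {u}) = d u" if u: "u \<in> C" for u
  proof -
    have "{e \<in> edges G. u \<in> e} = (\<lambda>v. {u, v}) ` ((C - {u}) \<union> E `` {u})"
    proof (intro equalityI subsetI)
      fix e assume e: "e \<in> {e \<in> edges G. u \<in> e}"
      then show "e \<in> (\<lambda>v. {u, v}) ` ((C - {u}) \<union> E `` {u})"
        using edge_cases[of e] u CI(2) by (auto simp: K_def E_def card_2_iff)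
    next
      fix e assume "e \<in> (\<lambda>v. {u, v}) ` ((C - {u}) \<union> E `` {u})"
      then show "e \<in> {e \<in> edges G. u \<in> e}" using clique u by (auto simp: E_def)
    qed
    moreover have "inj_on (\<lambda>v. {u, v}) ((C - {u}) \<union> E `` {u})"
      by (auto simp: inj_on_def doubleton_eq_iff)
    ultimately have "vdegree G u = card ((C - {u}) \<union> E `` {u})"
      by (simp add: vdegree_def card_image)
    also have "\<dots> = card (C - {u}) + card (E `` {u})"
      using fin finE CI(2) by (intro card_Un_disjoint) (auto simp: E_def)
    finally show ?thesis using u fin card_gt_0_iff[of C] by (auto simp: d_def card_Diff_singleton)
  qed
  have dI: "card (E\<inverse> `` {v}) = vdegree G v" if v: "v \<in> I" for v
  proof -
    have "{e \<in> edges G. v \<in> e} = (\<lambda>u. {u, v}) ` (E\<inverse> `` {v})"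
    proof (intro equalityI subsetI)
      fix e assume e: "e \<in> {e \<in> edges G. v \<in> e}"
      then show "e \<in> (\<lambda>u. {u, v}) ` (E\<inverse> `` {v})"
        using edge_cases[of e] v CI(2) by (auto simp: K_def E_def)
    qed (auto simp: E_def)
    moreover have "inj_on (\<lambda>u. {u, v}) (E\<inverse> `` {v})" by (auto simp: inj_on_def doubleton_eq_iff)
    ultimately show ?thesis by (simp add: vdegree_def card_image)
  qed

  have "\<exists>c :: 'a \<times> 'a \<Rightarrow> nat. (\<forall>(x, y)\<in>E. c (x, y) \<in> {1..card (E `` {x})}) \<and>
      (\<forall>x. inj_on (\<lambda>y. c (x, y)) (E `` {x})) \<and> (\<forall>y. inj_on (\<lambda>x. c (x, y)) (E\<inverse> `` {y}))"
  proof (rule bipartite_coloring_initial_palette[OF finE])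
    show "Domain E \<inter> Range E = {}" using CI(2) by (auto simp: E_def)
    \<comment> \<open>This bound only drives the induction in that lemma and does not enter the
      palettes, so a crude one suffices.\<close>
    show "card (E `` {x}) \<le> card E" for x
      using card_mono[of "snd ` E" "E `` {x}"] card_image_le[OF finE, of snd] finE by force
    show "card (E\<inverse> `` {y}) \<le> card (E `` {x})" if "(x, y) \<in> E" for x y
      using that cond[of x y] dC[of x] dI[of y] by (simp add: E_def)
  qed
  then obtain c :: "'a \<times> 'a \<Rightarrow> nat" where
    c_range: "\<And>u v. (u, v) \<in> E \<Longrightarrow> c (u, v) \<in> {1..card (E `` {u})}"
    and cC: "\<And>u. inj_on (\<lambda>v. c (u, v)) (E `` {u})"
    and cI: "\<And>v. inj_on (\<lambda>u. c (u, v)) (E\<inverse> `` {v})"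
    by blast
  obtain k where k: "proper_edge_coloring \<lparr>verts = C, edges = K\<rparr> k" "\<And>e. k e \<in> {1..N}"
    using complete_graph_coloring[OF fin(1) N] unfolding K_def by blast

  \<comment> \<open>The ends of a crossing edge are recovered as its unique elements in
    \<open>C\<close> and in \<open>I\<close>.\<close>
  define \<alpha> where "\<alpha> e = (if e \<subseteq> C then a + k e
    else b + c (the_elem (e \<inter> C), the_elem (e \<inter> I)))" for e
  have \<alpha>K: "\<alpha> e = a + k e" if "e \<in> K" for e
    using that by (simp add: \<alpha>_def K_def)
  have \<alpha>E: "\<alpha> {u, v} = b + c (u, v)" if uv: "(u, v) \<in> E" for u v
  proof -
    have "{u, v} \<inter> C = {u}" "{u, v} \<inter> I = {v}" using uv CI(2) by (auto simp: E_def)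
    then show ?thesis using E_not_clique[OF uv] by (simp add: \<alpha>_def del: insert_subset)
  qed
  \<comment> \<open>Either the crossing color is at most \<open>d u \<le> a\<close> and the clique
    color exceeds \<open>a\<close>, or the clique color is at most \<open>N\<close> and the crossing
    color exceeds \<open>N\<close>.\<close>
  have mixed: "\<alpha> e \<noteq> \<alpha> {u, v}" if "e \<in> K" "(u, v) \<in> E" for e u v
  proof -
    have "c (u, v) \<in> {1..d u}" "u \<in> C" using c_range[OF that(2)] dC[of u] that(2) by (auto simp: E_def)
    then show ?thesis using ab k(2)[of e] \<alpha>K \<alpha>E that by fastforce
  qed
  have "proper_edge_coloring G \<alpha>"
    unfolding proper_edge_coloring_def
  proof (intro conjI ballI impI)
    fix e assume "e \<in> edges G"
    then show "1 \<le> \<alpha> e"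
      using edge_cases[of e] k(2)[of e] \<alpha>K[of e] \<alpha>E c_range by fastforce
  next
    fix e f assume e: "e \<in> edges G" and f: "f \<in> edges G" and ef: "e \<noteq> f \<and> e \<inter> f \<noteq> {}"
    consider "e \<in> K" "f \<in> K" | u v where "e \<in> K" "(u, v) \<in> E" "f = {u, v}"
      | u v where "f \<in> K" "(u, v) \<in> E" "e = {u, v}"
      | u v u' v' where "(u, v) \<in> E" "e = {u, v}" "(u', v') \<in> E" "f = {u', v'}"
      using edge_cases[OF e] edge_cases[OF f] by blast
    then show "\<alpha> e \<noteq> \<alpha> f"
    proof cases
      case 1
      then show ?thesis using k(1) ef by (simp add: \<alpha>K proper_edge_coloring_def)
    next
      case 2
      then show ?thesis using mixed by blast
    next
      case 3
      then show ?thesis using mixed[of f u v] by simp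
    next
      case 4
      \<comment> \<open>Two crossing edges can only share an end on the same side.\<close>
      then have "u \<noteq> v'" "v \<noteq> u'" using CI(2) by (auto simp: E_def)
      then consider "u = u'" "v \<noteq> v'" | "v = v'" "u \<noteq> u'" using ef 4 by auto
      then show ?thesis
      proof cases
        case 1
        then show ?thesis using inj_onD[OF cC[of u], of v v'] 4 by (auto simp: \<alpha>E)
      next
        case 2
        then show ?thesis using inj_onD[OF cI[of v], of u u'] 4 by (auto simp: \<alpha>E)
      qed
    qed
  qed
  then have "edge_chromatic_sum G \<le> coloring_sum G \<alpha>" by (rule edge_chromatic_sum_le)
  also have "coloring_sum G \<alpha> = (\<Sum>e\<in>K. \<alpha> e) + (\<Sum>e\<in>(\<lambda>(u, v). {u, v}) ` E. \<alpha> e)"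
    unfolding coloring_sum_def edges
    using finK finE E_not_clique by (intro sum.union_disjoint) (auto simp: K_def)
  also have "(\<Sum>e\<in>K. \<alpha> e) = a * card K + (\<Sum>e\<in>K. k e)"
    using \<alpha>K by (simp add: sum.distrib)
  also have "card K = card C choose 2"
    using n_subsets[OF fin(1), of 2] by (simp add: K_def)
  also have "(\<Sum>e\<in>K. k e) \<le> (\<Sum>i=1..N. i) * (card C div 2)"
  proof -
    have "card {e \<in> K. k e = i} \<le> card C div 2" for i
      using proper_edge_coloring_class_le[OF fin(1) _ k(1)] by (simp add: K_def)
    moreover have "{e \<in> K. k e \<in> {1..N}} = K" using k(2) by blast
    ultimately show ?thesis using sum_weight_le[OF finK, of k _ "\<lambda>i. i" N] by simp
  qed
  also have "(\<Sum>e\<in>(\<lambda>(u, v). {u, v}) ` E. \<alpha> e) = (\<Sum>(u, v)\<in>E. b + c (u, v))"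
    using inj by (simp add: sum.reindex case_prod_unfold) (intro sum.cong, auto simp: \<alpha>E)
  also have "E = Sigma C (\<lambda>u. E `` {u})" by (auto simp: E_def)
  also have "(\<Sum>(u, v)\<in>Sigma C (\<lambda>u. E `` {u}). b + c (u, v)) = (\<Sum>u\<in>C. \<Sum>v\<in>E `` {u}. b + c (u, v))"
    using fin finE by (intro sum.Sigma[symmetric]) auto
  also have "\<dots> = (\<Sum>u\<in>C. b * d u + (\<Sum>i=1..d u. i))"
  proof (rule sum.cong[OF refl])
    fix u assume u: "u \<in> C"
    \<comment> \<open>The \<open>d u\<close> crossing edges at \<open>u\<close> have distinct colors
      in \<open>{1..d u}\<close> before the shift, so they use each exactly once.\<close>
    have "(\<Sum>v\<in>E `` {u}. c (u, v)) = (\<Sum>i=1..card (E `` {u}). i)"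
      using finE cC c_range by (intro sum_inj_initial_segment) auto
    then show "(\<Sum>v\<in>E `` {u}. b + c (u, v)) = b * d u + (\<Sum>i=1..d u. i)"
      by (simp add: sum.distrib dC[OF u])
  qed
  finally show ?thesis by simp
qed

section \<open>The bounds in closed form\<close>

lemma real_gauss_sum: "real (\<Sum>i=1..n. i) = real n * (real n + 1) / 2"
  by (induction n) (simp_all add: field_simps)

theorem theorem13:
  fixes G :: "'a graph" and C I :: "'a set" and n :: nat
  assumes "simple_graph G"
    and "split_partition G C I"
    and "card C = n"
    and "\<forall>u\<in>C. \<forall>v\<in>I. {u, v} \<in> edges G \<longrightarrow>
           real (vdegree G u) - real (vdegree G v) \<ge> real n - 1"
  shows "(even n \<longrightarrow>
           real (edge_chromatic_sum G) \<le>
             min ((\<Sum>u\<in>C. (real (vdegree G u) - real n + 1) * (real (vdegree G u) - real n + 2) / 2)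
                    + (2 * real (max_degree G) - real n + 2) * real n * (real n - 1) / 4)
                 (real (edge_chromatic_sum (complete_graph n))
                    + (\<Sum>u\<in>C. (real (vdegree G u) - real n + 1) * (real (vdegree G u) + real n) / 2))) \<and>
         (odd n \<longrightarrow>
           real (edge_chromatic_sum G) \<le>
             min ((\<Sum>u\<in>C. (real (vdegree G u) - real n + 1) * (real (vdegree G u) - real n + 2) / 2)
                    + (2 * real (max_degree G) - real n + 3) * real n * (real n - 1) / 4)
                 (real (edge_chromatic_sum (complete_graph n))
                    + (\<Sum>u\<in>C. (real (vdegree G u) - real n + 1) * (real (vdegree G u) + real n + 2) / 2)))"
proof -
  note simple = assms(1) and split = assms(2) and n = assms(3)
  have finC: "finite C" and CV: "C \<subseteq> verts G" and finV: "finite (verts G)"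
    using simple split by (auto simp: simple_graph_def split_partition_def)
  define d where "d u = vdegree G u + 1 - n" for u
  have deg_ge: "n \<le> vdegree G u + 1" if u: "u \<in> C" for u
  proof -
    have "card ((\<lambda>v. {u, v}) ` (C - {u})) \<le> vdegree G u"
      unfolding vdegree_def using simple_graph_finite_edges[OF simple] split u
      by (intro card_mono) (auto simp: split_partition_def clique_def)
    moreover have "inj_on (\<lambda>v. {u, v}) (C - {u})" by (auto simp: inj_on_def doubleton_eq_iff)
    ultimately show ?thesis using u finC n by (simp add: card_image card_Diff_singleton)
  qed
  have d_real: "real (d u) = real (vdegree G u) - real n + 1" if "u \<in> C" for u
    using deg_ge[OF that] by (simp add: d_def of_nat_diff)
  have cond: "vdegree G v \<le> d u" if "u \<in> C" "v \<in> I" "{u, v} \<in> edges G" for u v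
  proof -
    have "real (vdegree G v) \<le> real (d u)" using assms(4) that d_real[OF that(1)] by fastforce
    then show ?thesis by simp
  qed
  have max: "vdegree G u \<le> max_degree G" if "u \<in> C" for u
    using that CV finV unfolding max_degree_def by (intro Max_ge) auto
  have ch: "real (n choose 2) = real n * (real n - 1) / 2"
    by (induction n) (simp_all add: numeral_2_eq_2 field_simps)

  text \<open>For n = 0 the odd number N is arbitrary, as there is nothing to color.\<close>
  define N where "N = (if even n then if n = 0 then 1 else n - 1 else n)"
  have N: "odd N" "card C \<le> N + 1" using n by (auto simp: N_def)
  \<comment> \<open>For even \<open>n > 0\<close> this is \<open>(n - 1) * (n div 2)\<close>, for
    odd \<open>n\<close> it is \<open>n * ((n - 1) div 2)\<close>; for \<open>n = 0\<close> both
    sides vanish.\<close>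
  have Nh: "n choose 2 = N * (n div 2)"
    by (auto simp: N_def choose_two elim!: evenE oddE)
  define S where "S = (\<Sum>i=1..N. i) * (n div 2)"

  \<comment> \<open>The least shift that is certain to clear all crossing colors: \<open>d u\<close>
    is at most the maximum degree minus \<open>n - 1\<close>.\<close>
  define a where "a = max_degree G + 1 - n"
  have "edge_chromatic_sum G \<le> a * (n choose 2) + S + (\<Sum>u\<in>C. 0 * d u + (\<Sum>i=1..d u. i))"
    using split_graph_coloring[OF simple split _ N, of 0 a] cond max n
    by (simp add: S_def d_def a_def diff_le_mono)
  then have "real (edge_chromatic_sum G) \<le>
      real (a * (n choose 2) + S + (\<Sum>u\<in>C. 0 * d u + (\<Sum>i=1..d u. i)))"
    by (rule of_nat_mono)
  moreover have "real (a * (n choose 2)) = (real (max_degree G) + 1 - real n) * (real n * (real n - 1) / 2)"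
  \<comment> \<open>Without clique vertices \<open>n = 0\<close> and both sides vanish. Otherwise a
    vertex of \<open>C\<close> shows that the subtraction in \<open>a\<close> is exact.\<close>
  proof (cases "C = {}")
    case False
    then obtain u where "u \<in> C" by blast
    then have "n \<le> max_degree G + 1" using deg_ge[of u] max[of u] by simp
    then show ?thesis by (simp add: ch a_def of_nat_diff)
  qed (use n in simp)
  moreover have "real (\<Sum>u\<in>C. 0 * d u + (\<Sum>i=1..d u. i)) = (\<Sum>u\<in>C.
      (real (vdegree G u) - real n + 1) * (real (vdegree G u) - real n + 2) / 2)"
    unfolding of_nat_sum[where A=C]
    by (intro sum.cong refl) (simp add: real_gauss_sum d_real del: of_nat_sum One_nat_def)
  ultimately have bound1: "real (edge_chromatic_sum G) \<le>
      (\<Sum>u\<in>C. (real (vdegree G u) - real n + 1) * (real (vdegree G u) - real n + 2) / 2)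
      + (real (max_degree G) + 1 - real n) * (real n * (real n - 1) / 2) + real S"
    by simp

  have "edge_chromatic_sum G \<le> 0 * (n choose 2) + S + (\<Sum>u\<in>C. N * d u + (\<Sum>i=1..d u. i))"
    using split_graph_coloring[OF simple split _ N, of N 0] cond n by (simp add: S_def d_def)
  \<comment> \<open>\<open>S\<close> bounds the cost of the unshifted clique coloring from above and
    the edge-chromatic sum of the complete graph from below.\<close>
  also have "S \<le> edge_chromatic_sum (complete_graph n)"
    unfolding S_def by (rule edge_chromatic_sum_complete_graph_ge[OF Nh])
  finally have "real (edge_chromatic_sum G) \<le>
      real (edge_chromatic_sum (complete_graph n) + (\<Sum>u\<in>C. N * d u + (\<Sum>i=1..d u. i)))"
    by (simp del: of_nat_sum of_nat_add One_nat_def)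
  \<comment> \<open>\<open>N * d u + d u * (d u + 1) / 2\<close> is factored as
    \<open>d u * (2 * N + d u + 1) / 2\<close>.\<close>
  moreover have "real (\<Sum>u\<in>C. N * d u + (\<Sum>i=1..d u. i)) = (\<Sum>u\<in>C.
      (real (vdegree G u) - real n + 1) * (2 * real N + real (vdegree G u) - real n + 2) / 2)"
    unfolding of_nat_sum[where A=C]
    by (intro sum.cong refl) (simp add: real_gauss_sum d_real field_simps del: of_nat_sum One_nat_def)
  ultimately have bound2: "real (edge_chromatic_sum G) \<le> real (edge_chromatic_sum (complete_graph n))
      + (\<Sum>u\<in>C. (real (vdegree G u) - real n + 1) * (2 * real N + real (vdegree G u) - real n + 2) / 2)"
    by simp

  have S_real: "real S = real N * (real N + 1) / 2 * real (n div 2)"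
    by (simp add: S_def real_gauss_sum del: of_nat_sum One_nat_def)
  show ?thesis
  proof (intro conjI impI min.boundedI)
    assume even: "even n"
    then have "real S = real n * (real n - 1) * real n / 4"
      by (auto simp: S_real N_def real_of_nat_div of_nat_diff field_simps)
    then have "(real (max_degree G) + 1 - real n) * (real n * (real n - 1) / 2) + real S
        = (2 * real (max_degree G) - real n + 2) * real n * (real n - 1) / 4"
      by (simp add: field_simps)
    then show "real (edge_chromatic_sum G) \<le>
        (\<Sum>u\<in>C. (real (vdegree G u) - real n + 1) * (real (vdegree G u) - real n + 2) / 2)
        + (2 * real (max_degree G) - real n + 2) * real n * (real n - 1) / 4"
      using bound1 by linarith
    \<comment> \<open>The identity needs \<open>N = n - 1\<close>, which fails for
      \<open>n = 0\<close>; a vertex \<open>u\<close> of \<open>C\<close> rules that case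
      out.\<close>
    have "2 * real N + real (vdegree G u) - real n + 2 = real (vdegree G u) + real n" if "u \<in> C" for u
    proof -
      have "n > 0" using that n finC card_gt_0_iff by blast
      then show ?thesis using even by (simp add: N_def of_nat_diff)
    qed
    then show "real (edge_chromatic_sum G) \<le> real (edge_chromatic_sum (complete_graph n))
        + (\<Sum>u\<in>C. (real (vdegree G u) - real n + 1) * (real (vdegree G u) + real n) / 2)"
      using bound2 by (simp only: cong: sum.cong)
  next
    assume odd: "odd n"
    then have "real (n div 2) = (real n - 1) / 2" by (auto elim: oddE)
    then have "real S = real n * (real n + 1) * (real n - 1) / 4"
      using odd by (simp add: S_real N_def)
    then have "(real (max_degree G) + 1 - real n) * (real n * (real n - 1) / 2) + real S
        = (2 * real (max_degree G) - real n + 3) * real n * (real n - 1) / 4"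
      by (simp add: field_simps)
    then show "real (edge_chromatic_sum G) \<le>
        (\<Sum>u\<in>C. (real (vdegree G u) - real n + 1) * (real (vdegree G u) - real n + 2) / 2)
        + (2 * real (max_degree G) - real n + 3) * real n * (real n - 1) / 4"
      using bound1 by linarith
    have "2 * real N + real (vdegree G u) - real n + 2 = real (vdegree G u) + real n + 2" for u
      using odd by (simp add: N_def)
    then show "real (edge_chromatic_sum G) \<le> real (edge_chromatic_sum (complete_graph n))
        + (\<Sum>u\<in>C. (real (vdegree G u) - real n + 1) * (real (vdegree G u) + real n + 2) / 2)"
      using bound2 by (simp only:)
  qed
qed

end
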